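(* Every finite projective plane of order greater than $10^{54}$ admits a legitimate coloring with $8$ colors.
   Context: A finite projective plane of order $n$ has point set $P$ and line set $L$ with $|P|=|L|=n^2+n+1$, each line (viewed as a set of points) having $n+1$ points and each point lying on $n+1$ lines. For a coloring $g:P\to\{1,\dots,c\}$, the type of a line $\ell$ is the vector $(|\ell\cap g^{-1}(1)|,\dots,|\ell\cap g^{-1}(c)|)$. A coloring with $c$ colors is legitimate if distinct lines have distinct types. *)

theory Defs
  imports "HOL-Library.FuncSet"
begin

text \<open>
  Lines are identified with the sets of points on them. Besides the incidence axioms and
  nondegeneracy (four points, no three on a line), the only numerical assumption is the size of
  a line; the remaining counts for a plane of order \<open>n\<close> are derived below.
\<close>

locale finite_projective_plane =
  fixes P :: "'a set" and L :: "'a set set" and n :: nat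
  assumes finite_points: "finite P"
    and line_subset: "l \<in> L \<Longrightarrow> l \<subseteq> P"
    and unique_line: "\<lbrakk>p \<in> P; q \<in> P; p \<noteq> q\<rbrakk> \<Longrightarrow> \<exists>!l. l \<in> L \<and> p \<in> l \<and> q \<in> l"
    and unique_point: "\<lbrakk>l \<in> L; m \<in> L; l \<noteq> m\<rbrakk> \<Longrightarrow> \<exists>!p. p \<in> l \<inter> m"
    and quadrangle: "\<exists>Q\<subseteq>P. card Q = 4 \<and> (\<forall>l\<in>L. card (l \<inter> Q) \<le> 2)"
    and card_line: "l \<in> L \<Longrightarrow> card l = n + 1"
begin

lemma finite_line: "l \<in> L \<Longrightarrow> finite l"
  using finite_points line_subset finite_subset by blast

lemma finite_lines: "finite L"
  using finite_points line_subset by (meson Pow_iff finite_Pow_iff rev_finite_subset subsetI)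

lemma ex_line_avoiding: "\<exists>l\<in>L. p \<notin> l"
proof (rule ccontr)
  assume "\<not> (\<exists>l\<in>L. p \<notin> l)"
  then have all: "p \<in> l" if "l \<in> L" for l using that by blast
  obtain Q where Q: "Q \<subseteq> P" "card Q = 4" "\<And>l. l \<in> L \<Longrightarrow> card (l \<inter> Q) \<le> 2"
    using quadrangle by blast
  have "finite Q" using Q(2) by (metis card.infinite zero_neq_numeral)
  then have "3 \<le> card (Q - {p})" using Q(2) by (cases "p \<in> Q") auto
  then obtain T where T: "T \<subseteq> Q - {p}" "card T = 3" by (meson obtain_subset_with_card_n)
  then obtain a b c where abc: "T = {a, b, c}" "a \<noteq> b" "a \<noteq> c" "b \<noteq> c"
    by (auto simp: card_3_iff)
  have inP: "a \<in> P" "b \<in> P" "c \<in> P" "a \<noteq> p" using T abc Q(1) by auto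
  obtain l where l: "l \<in> L" "a \<in> l" "b \<in> l" using unique_line[OF inP(1,2) abc(2)] by blast
  obtain m where m: "m \<in> L" "a \<in> m" "c \<in> m" using unique_line[OF inP(1,3) abc(3)] by blast
  have "l = m" using unique_point[OF l(1) m(1)] all[OF l(1)] all[OF m(1)] l m inP(4) by blast
  then have "T \<subseteq> l \<inter> Q" using T abc l m by auto
  then have "card T \<le> card (l \<inter> Q)" using \<open>finite Q\<close> by (simp add: card_mono)
  then show False using T(2) Q(3)[OF l(1)] by simp
qed

lemma card_lines_through:
  assumes p: "p \<in> P"
  shows "card {l \<in> L. p \<in> l} = n + 1"
proof -
  obtain l where l: "l \<in> L" "p \<notin> l" using ex_line_avoiding by blast
  have "bij_betw (\<lambda>m. THE q. q \<in> l \<inter> m) {m \<in> L. p \<in> m} l"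
  proof (rule bij_betw_imageI)
    have the: "(THE q. q \<in> l \<inter> m) \<in> l \<inter> m" if "m \<in> L" "p \<in> m" for m
      using theI'[OF unique_point[OF l(1) that(1)]] l(2) that(2) by blast
    show "inj_on (\<lambda>m. THE q. q \<in> l \<inter> m) {m \<in> L. p \<in> m}"
    proof (rule inj_onI)
      fix m m'
      assume m: "m \<in> {m \<in> L. p \<in> m}" "m' \<in> {m \<in> L. p \<in> m}"
        and eq: "(THE q. q \<in> l \<inter> m) = (THE q. q \<in> l \<inter> m')"
      define q where "q = (THE q. q \<in> l \<inter> m)"
      have q: "q \<in> l" "q \<in> m" "q \<in> m'" using the[of m] the[of m'] m eq q_def by auto
      then have "q \<noteq> p" "q \<in> P" using l line_subset by auto
      then show "m = m'" using unique_line[OF p] m q by blast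
    qed
    show "(\<lambda>m. THE q. q \<in> l \<inter> m) ` {m \<in> L. p \<in> m} = l"
    proof (intro equalityI subsetI)
      fix q assume q: "q \<in> l"
      then have "p \<noteq> q" "q \<in> P" using l line_subset by auto
      then obtain m where m: "m \<in> L" "p \<in> m" "q \<in> m" using unique_line[OF p] by blast
      then have "(THE q. q \<in> l \<inter> m) = q"
        using the_equality unique_point[OF l(1) m(1)] l(2) q by (metis IntI)
      then show "q \<in> (\<lambda>m. THE q. q \<in> l \<inter> m) ` {m \<in> L. p \<in> m}" using m by force
    qed (use the in auto)
  qed
  then show ?thesis using bij_betw_same_card card_line l(1) by metis
qed

theorem card_points: "card P = n\<^sup>2 + n + 1"
proof -
  have "P \<noteq> {}" using quadrangle by force
  then obtain p where p: "p \<in> P" by blast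
  let ?A = "{l \<in> L. p \<in> l}"
  have "P - {p} = (\<Union>l\<in>?A. l - {p})"
  proof (intro equalityI subsetI)
    fix q assume "q \<in> P - {p}"
    then have "q \<in> P" "p \<noteq> q" by auto
    then obtain l where "l \<in> L" "p \<in> l" "q \<in> l" using unique_line[OF p] by blast
    then show "q \<in> (\<Union>l\<in>?A. l - {p})" using \<open>p \<noteq> q\<close> by auto
  qed (use line_subset in auto)
  moreover have "card (\<Union>l\<in>?A. l - {p}) = (\<Sum>l\<in>?A. card (l - {p}))"
  proof (rule card_UN_disjoint)
    show "\<forall>l\<in>?A. \<forall>m\<in>?A. l \<noteq> m \<longrightarrow> (l - {p}) \<inter> (m - {p}) = {}"
    proof (intro ballI impI)
      fix l m assume lm: "l \<in> ?A" "m \<in> ?A" "l \<noteq> m"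
      then have "\<exists>!q. q \<in> l \<inter> m" using unique_point[of l m] by simp
      then show "(l - {p}) \<inter> (m - {p}) = {}" using lm by blast
    qed
  qed (use finite_lines finite_line in auto)
  moreover have "(\<Sum>l\<in>?A. card (l - {p})) = (\<Sum>l\<in>?A. n)"
    by (rule sum.cong) (auto simp: card_line finite_line)
  ultimately have "card (P - {p}) = (n + 1) * n"
    by (simp only: sum_constant card_lines_through[OF p]) simp
  then show ?thesis
    using card_Suc_Diff1[OF finite_points p] by (simp add: power2_eq_square)
qed

theorem card_lines: "card L = n\<^sup>2 + n + 1"
proof -
  have "(\<Sum>l\<in>L. card {p \<in> P. p \<in> l}) = (n + 1) * card P"
    by (rule sum_multicount[OF finite_lines finite_points]) (use card_lines_through in auto)
  moreover have "(\<Sum>l\<in>L. card {p \<in> P. p \<in> l}) = (\<Sum>l\<in>L. n + 1)"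
  proof (rule sum.cong)
    fix l assume "l \<in> L"
    then have "{p \<in> P. p \<in> l} = l" using line_subset by auto
    then show "card {p \<in> P. p \<in> l} = n + 1" using card_line \<open>l \<in> L\<close> by simp
  qed simp
  ultimately have "(n + 1) * card L = (n + 1) * card P" by (simp add: mult.commute)
  then have "card L = card P" by (simp only: mult_cancel1) simp
  then show ?thesis using card_points by simp
qed

end

text \<open>
  Types are vectors indexed by \<open>{1..c}\<close>; the restriction makes function equality coincide with
  equality of these vectors.
\<close>

definition line_type :: "nat \<Rightarrow> ('a \<Rightarrow> nat) \<Rightarrow> 'a set \<Rightarrow> nat \<Rightarrow> nat" where
  "line_type c g l = (\<lambda>i\<in>{1..c}. card (l \<inter> g -` {i}))"

definition legitimate_coloring :: "'a set \<Rightarrow> 'a set set \<Rightarrow> nat \<Rightarrow> ('a \<Rightarrow> nat) \<Rightarrow> bool" where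
  "legitimate_coloring P L c g \<longleftrightarrow>
     g \<in> P \<rightarrow> {1..c} \<and> (\<forall>l\<in>L. \<forall>m\<in>L. l \<noteq> m \<longrightarrow> line_type c g l \<noteq> line_type c g m)"

end

theory Submission
  imports Defs Complex_Main
begin

text \<open>
  Color the points uniformly at random with 8 colors. Whatever the colors outside a line, the type
  of the line takes any given value with probability of order \<open>n\<^sup>-\<^sup>7\<^sup>/\<^sup>2\<close>, the maximum of
  a multinomial distribution with 8 equal weights. Hence two lines have equal (or boundedly close)
  types with probability \<open>O(n\<^sup>-\<^sup>7\<^sup>/\<^sup>2)\<close>, and two given lines are both close to a third with
  probability \<open>O(n\<^sup>-\<^sup>7)\<close>. As there are about \<open>n\<^sup>4\<close> pairs and \<open>n\<^sup>6\<close> triples of lines, some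
  coloring has \<open>O(n\<^sup>1\<^sup>/\<^sup>2)\<close> close pairs, pairwise disjoint. From each pair of lines of equal type
  recolor one point of one of the two lines, chosen greedily on no other line occurring in a close
  pair and so that no line receives more than 200 recolored points. This separates the bad pairs,
  does not affect the other close pairs, and cannot identify types that differ by more than 400
  in some color.
\<close>

section \<open>Peak probability of a multinomial count vector\<close>

definition cnt :: "('a \<Rightarrow> nat) \<Rightarrow> 'a set \<Rightarrow> nat \<Rightarrow> nat" where
  "cnt g A i = card {x \<in> A. g x = i}"

text \<open>For q > 0 this is the largest multinomial probability with q equal weights. A most
  balanced count vector of n points has an entry \<open>n div q\<close>; raising it by one
  multiplies the multinomial coefficient by \<open>(n + 1) / (n div q + 1)\<close>, and the new
  point costs a further factor 1/q.\<close>

primrec peak :: "nat \<Rightarrow> nat \<Rightarrow> real" where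
  "peak q 0 = 1"
| "peak q (Suc n) = peak q n * (real (Suc n) / real (q * (n div q + 1)))"

lemma peak_nonneg: "0 \<le> peak q n"
  by (induction n) auto

lemma peak_Suc_le: "0 < q \<Longrightarrow> peak q (Suc n) \<le> peak q n"
proof -
  assume q: "0 < q"
  have "Suc n \<le> q * (n div q + 1)"
    using q dividend_less_times_div[of q n] by (simp add: Suc_le_eq)
  then have "real (Suc n) / real (q * (n div q + 1)) \<le> 1"
    using q by (subst divide_le_eq_1) (auto simp del: of_nat_Suc of_nat_mult)
  then show ?thesis
    using mult_left_mono[OF _ peak_nonneg] by fastforce
qed

lemma peak_antimono: "0 < q \<Longrightarrow> m \<le> n \<Longrightarrow> peak q n \<le> peak q m"
  using lift_Suc_antimono_le[of "peak q"] peak_Suc_le by blast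

lemma cnt_cong: "(\<And>x. x \<in> A \<Longrightarrow> g x = h x) \<Longrightarrow> cnt g A i = cnt h A i"
  unfolding cnt_def by (rule arg_cong[of _ _ card]) auto

lemma cnt_split: "finite l \<Longrightarrow> A \<subseteq> l \<Longrightarrow> cnt g l i = cnt g A i + cnt g (l - A) i"
  unfolding cnt_def
  by (subst card_Un_disjoint[symmetric]) (auto intro!: arg_cong[of _ _ card] dest: finite_subset)

lemma sum_cnt:
  assumes "finite A" "g \<in> A \<rightarrow> C" "finite C"
  shows "(\<Sum>i\<in>C. cnt g A i) = card A"
proof -
  have "(\<Sum>i\<in>C. cnt g A i) = card (\<Union>i\<in>C. {x \<in> A. g x = i})"
    unfolding cnt_def by (rule card_UN_disjoint[symmetric]) (use assms in auto)
  also have "(\<Union>i\<in>C. {x \<in> A. g x = i}) = A" using assms(2) by auto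
  finally show ?thesis .
qed

definition colorings_with_counts :: "nat \<Rightarrow> 'a set \<Rightarrow> (nat \<Rightarrow> nat) \<Rightarrow> ('a \<Rightarrow> nat) set" where
  "colorings_with_counts q A \<tau> = {a \<in> A \<rightarrow>\<^sub>E {1..q}. \<forall>i\<in>{1..q}. cnt a A i = \<tau> i}"

lemma finite_colorings_with_counts: "finite A \<Longrightarrow> finite (colorings_with_counts q A \<tau>)"
  unfolding colorings_with_counts_def by (simp add: finite_PiE)

text \<open>
  Deleting a point of the most frequent color, which occurs at least \<open>n div q + 1\<close> times among
  \<open>n + 1\<close> points, gives the recursion of \<^const>\<open>peak\<close>.
\<close>

lemma card_colorings_with_counts:
  assumes "finite A" "0 < q"
  shows "real (card (colorings_with_counts q A \<tau>)) \<le> real q ^ card A * peak q (card A)"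
  using assms(1)
proof (induction "card A" arbitrary: A \<tau>)
  case 0
  then have "A = {}" by simp
  then have "colorings_with_counts q A \<tau> \<subseteq> {\<lambda>_. undefined}"
    unfolding colorings_with_counts_def by auto
  then have "card (colorings_with_counts q A \<tau>) \<le> 1"
    using card_mono[of "{\<lambda>_. undefined}"] by simp
  then show ?case using 0 by simp
next
  case (Suc n)
  let ?S = "colorings_with_counts q A \<tau>"
  show ?case
  proof (cases "?S = {}")
    case True
    then show ?thesis using peak_nonneg by simp
  next
    case False
    then obtain a where a: "a \<in> ?S" by blast
    have "\<exists>i\<in>{1..q}. n div q + 1 \<le> \<tau> i"
    proof (rule ccontr)
      assume "\<not> ?thesis"
      then have "\<forall>i\<in>{1..q}. cnt a A i \<le> n div q"
        using a unfolding colorings_with_counts_def by force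
      then have "(\<Sum>i\<in>{1..q}. cnt a A i) \<le> q * (n div q)"
        using sum_bounded_above[of "{1..q}" "cnt a A" "n div q"] by simp
      moreover have "(\<Sum>i\<in>{1..q}. cnt a A i) = Suc n"
        using sum_cnt[of A a "{1..q}"] a Suc unfolding colorings_with_counts_def by auto
      ultimately show False
        using times_div_less_eq_dividend[of q n] by linarith
    qed
    then obtain i where i: "i \<in> {1..q}" "n div q + 1 \<le> \<tau> i" by blast
    define T where "T x = colorings_with_counts q (A - {x}) (\<tau>(i := \<tau> i - 1))" for x
    have fS: "finite ?S" and fT: "\<And>x. finite (T x)"
      unfolding T_def using Suc(3) by (simp_all add: finite_colorings_with_counts)
    \<comment> \<open>Double counting of pairs of a coloring g and a point x of color i. Deleting x
      leaves a coloring of \<open>A - {x}\<close> that uses color i once less, and nothing is lost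
      because x is known to have color i. Each g occurs in \<open>\<tau> i\<close> pairs.\<close>
    have "card (SIGMA g:?S. {x \<in> A. g x = i}) \<le> card (SIGMA x:A. T x)"
    proof (rule card_inj_on_le[where f = "\<lambda>(g, x). (x, restrict g (A - {x}))"])
      show "inj_on (\<lambda>(g, x). (x, restrict g (A - {x}))) (SIGMA g:?S. {x \<in> A. g x = i})"
      proof (rule inj_onI, clarsimp)
        fix g h x
        assume g: "g \<in> ?S" "h \<in> ?S" and x: "x \<in> A" "h x = g x" "i = g x"
          and e: "restrict g (A - {x}) = restrict h (A - {x})"
        show "g = h"
        proof (rule PiE_ext)
          show "g \<in> A \<rightarrow>\<^sub>E {1..q}" "h \<in> A \<rightarrow>\<^sub>E {1..q}"
            using g unfolding colorings_with_counts_def by auto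
          show "g y = h y" if "y \<in> A" for y
            using that x fun_cong[OF e, of y] by (cases "y = x") auto
        qed
      qed
      show "(\<lambda>(g, x). (x, restrict g (A - {x}))) ` (SIGMA g:?S. {x \<in> A. g x = i})
          \<subseteq> (SIGMA x:A. T x)"
      proof (clarsimp)
        fix g x assume g: "g \<in> ?S" and x: "x \<in> A" "i = g x"
        have c: "cnt (restrict g (A - {x})) (A - {x}) j = (\<tau>(i := \<tau> i - 1)) j"
          if "j \<in> {1..q}" for j
        proof -
          have "cnt (restrict g (A - {x})) (A - {x}) j = cnt g (A - {x}) j"
            by (rule cnt_cong) auto
          moreover have "cnt g A j = cnt g {x} j + cnt g (A - {x}) j"
            using cnt_split[of A "{x}"] x Suc by auto
          moreover have "cnt g {x} j = (if j = i then 1 else 0)"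
            using x unfolding cnt_def by (auto simp: card_1_singleton_iff intro!: exI[of _ x])
          moreover have "cnt g A j = \<tau> j"
            using g that unfolding colorings_with_counts_def by auto
          ultimately show ?thesis by auto
        qed
        then show "restrict g (A - {x}) \<in> T x"
          using g unfolding T_def colorings_with_counts_def by auto
      qed
      show "finite (SIGMA x:A. T x)" using Suc fT by auto
    qed
    moreover have "card (SIGMA g:?S. {x \<in> A. g x = i}) = card ?S * \<tau> i"
      using fS Suc i(1) by (subst card_SigmaI) (auto simp: colorings_with_counts_def cnt_def)
    moreover have "card (SIGMA x:A. T x) = (\<Sum>x\<in>A. card (T x))"
      using fT Suc by (subst card_SigmaI) auto
    ultimately have "card ?S * \<tau> i \<le> (\<Sum>x\<in>A. card (T x))" by simp
    then have "real (card ?S * \<tau> i) \<le> (\<Sum>x\<in>A. real (card (T x)))"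
      by (simp only: of_nat_sum[symmetric] of_nat_le_iff)
    also have "\<dots> \<le> (\<Sum>x\<in>A. real q ^ n * peak q n)"
    proof (rule sum_mono)
      fix x assume "x \<in> A"
      then have "n = card (A - {x})" using Suc by auto
      then show "real (card (T x)) \<le> real q ^ n * peak q n"
        using Suc(1)[of "A - {x}"] Suc(3) unfolding T_def by auto
    qed
    also have "\<dots> = real (Suc n) * (real q ^ n * peak q n)" using Suc(2) by simp
    finally have "real (card ?S) * real (\<tau> i) \<le> real (Suc n) * (real q ^ n * peak q n)" by simp
    moreover have "real (card ?S) * real (n div q + 1) \<le> real (card ?S) * real (\<tau> i)"
      using i(2) by (intro mult_left_mono) (auto simp del: of_nat_add)
    ultimately have "real (card ?S) * real (n div q + 1)
        \<le> real (Suc n) * (real q ^ n * peak q n)" by linarith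
    then have "real (card ?S) \<le> real (Suc n) * (real q ^ n * peak q n) / real (n div q + 1)"
      by (subst pos_le_divide_eq) auto
    also have "\<dots> = real q ^ card A * peak q (card A)"
    proof -
      define d where "d = real (n div q + 1)"
      have "real (Suc n) * (real q ^ n * peak q n) / d
          = real q ^ Suc n * (peak q n * (real (Suc n) / (real q * d)))"
        using assms(2) by simp
      also have "real q * d = real (q * (n div q + 1))" unfolding d_def by (rule of_nat_mult[symmetric])
      finally show ?thesis unfolding Suc(2)[symmetric] d_def by simp
    qed
    finally show ?thesis .
  qed
qed

text \<open>Passing from k to k + 1 multiplies \<open>peak 8 (8 * k)\<close> by the factors
  \<open>(8*K + j) / (8*K + 8)\<close> for j = 1, ..., 7, whose product is at most the seventh power
  of the middle one, (2K+1)/(2K+2). The square of that one is at most (3K+1)/(3K+4), the inequality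
  behind the classical bound 1 / sqrt(3k+1) for the normalized central binomial coefficient.
  Squaring keeps roots out of the induction.\<close>

lemma peak_8_decay: "(peak 8 (8 * k))\<^sup>2 * (3 * real k + 1) ^ 7 \<le> 1"
proof (induction k)
  case 0
  show ?case by simp
next
  case (Suc k)
  define K where "K = real k"
  have K: "0 \<le> K" unfolding K_def by simp
  define w where "w = (8 * K + 4)\<^sup>2"
  define N where "N = (8*K+1)*(8*K+7)*((8*K+2)*(8*K+6))*((8*K+3)*(8*K+5))*(8*K+4)"
  have one: "peak 8 (8 * k + Suc j) = peak 8 (8 * k + j) * ((8 * K + real (Suc j)) / (8 * K + 8))"
    if "j < 8" for j
    using that by (simp add: K_def ac_simps)
  have "8 * Suc k = 8 * k + Suc (Suc (Suc (Suc (Suc (Suc (Suc (Suc 0)))))))" by simp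
  then have "peak 8 (8 * Suc k) = peak 8 (8 * k) * ((8*K+1) / (8*K+8)) * ((8*K+2) / (8*K+8)) *
      ((8*K+3) / (8*K+8)) * ((8*K+4) / (8*K+8)) * ((8*K+5) / (8*K+8)) * ((8*K+6) / (8*K+8)) *
      ((8*K+7) / (8*K+8)) * ((8*K+8) / (8*K+8))"
    by (simp only: one) simp
  moreover have "(8*K+8) / (8*K+8) = 1" using K by simp
  ultimately have step: "peak 8 (8 * Suc k) = peak 8 (8 * k) * (N / (8 * K + 8) ^ 7)"
    unfolding N_def by (simp add: power_numeral_reduce ac_simps)
  have "N\<^sup>2 = ((8*K+1)*(8*K+7))\<^sup>2 * ((8*K+2)*(8*K+6))\<^sup>2 * ((8*K+3)*(8*K+5))\<^sup>2 * w"
    unfolding N_def w_def by (simp add: power_mult_distrib)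
  \<comment> \<open>The factors for j and 8 - j are paired: their product is at most
    (8K+4)^2.\<close>
  also have "\<dots> \<le> w\<^sup>2 * w\<^sup>2 * w\<^sup>2 * w"
    using K unfolding w_def
    by (intro mult_mono power_mono) (auto simp: power2_eq_square algebra_simps)
  also have "\<dots> = w ^ 7" by (simp add: power_numeral_reduce)
  finally have N2: "N\<^sup>2 \<le> w ^ 7" .
  have "w * (3*K+4) \<le> (8*K+8)\<^sup>2 * (3*K+1)"
    using K unfolding w_def by (simp add: power2_eq_square algebra_simps)
  then have "(w * (3*K+4)) ^ 7 \<le> ((8*K+8)\<^sup>2 * (3*K+1)) ^ 7"
    using K unfolding w_def by (intro power_mono) auto
  then have main: "N\<^sup>2 * (3*K+4) ^ 7 \<le> ((8*K+8)^7)\<^sup>2 * (3*K+1) ^ 7"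
    using order_trans[OF mult_right_mono[OF N2, of "(3*K+4)^7"]] K
    by (simp add: power_mult_distrib power_mult[symmetric])
  have pos: "0 < ((8*K+8)^7)\<^sup>2" using K by simp
  have "(peak 8 (8 * Suc k))\<^sup>2 * (3 * real (Suc k) + 1) ^ 7
      = (peak 8 (8 * k))\<^sup>2 * (N\<^sup>2 * (3*K+4) ^ 7 / ((8*K+8)^7)\<^sup>2)"
    unfolding step K_def[symmetric] power_mult_distrib power_divide by (simp add: K_def ac_simps)
  also have "\<dots> \<le> (peak 8 (8 * k))\<^sup>2 * (3*K+1) ^ 7"
  proof (rule mult_left_mono)
    show "N\<^sup>2 * (3*K+4) ^ 7 / ((8*K+8)^7)\<^sup>2 \<le> (3*K+1) ^ 7"
      using main pos by (simp add: pos_divide_le_eq mult.commute)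
  qed simp
  also have "\<dots> \<le> 1" using Suc unfolding K_def .
  finally show ?case .
qed

text \<open>The argument n - 1 is the number of points that two other lines are sure to leave free
  on a line.\<close>

lemma peak_8_bound:
  assumes "1000 \<le> n"
  shows "peak 8 (n - 1) \<le> 40 / (real n ^ 3 * sqrt (real n))"
proof -
  define k where "k = (n - 1) div 8"
  define r where "r = real n"
  have r: "1000 \<le> r" using assms by (simp add: r_def)
  have le: "peak 8 (n - 1) \<le> peak 8 (8 * k)"
    by (rule peak_antimono) (auto simp: k_def)
  have "n \<le> 8 * k + 8" unfolding k_def by linarith
  then have "real n \<le> real (8 * k + 8)" using of_nat_le_iff by blast
  \<comment> \<open>From n <= 8k + 8 follows 3k + 1 >= 3n/8 - 2, and n/80 absorbs the 2.\<close>
  then have k: "29 / 80 * r \<le> 3 * real k + 1" using r unfolding r_def by simp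
  have "(peak 8 (8 * k))\<^sup>2 * (29 / 80 * r) ^ 7 \<le> (peak 8 (8 * k))\<^sup>2 * (3 * real k + 1) ^ 7"
    using k r by (intro mult_left_mono power_mono) auto
  also have "\<dots> \<le> 1" by (rule peak_8_decay)
  finally have "(peak 8 (8 * k))\<^sup>2 * ((29 / 80) ^ 7 * r ^ 7) \<le> 1"
    by (simp only: power_mult_distrib)
  \<comment> \<open>The value 1/1600 lies below (29/80)^7 and is the inverse square of the final
    constant 40.\<close>
  moreover have "(peak 8 (8 * k))\<^sup>2 * (1 / 1600 * r ^ 7)
      \<le> (peak 8 (8 * k))\<^sup>2 * ((29 / 80) ^ 7 * r ^ 7)"
    using r by (intro mult_left_mono mult_right_mono) (auto simp: power_divide)
  ultimately have "(peak 8 (8 * k))\<^sup>2 * r ^ 7 \<le> 1600" by linarith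
  moreover have "(r ^ 3 * sqrt r)\<^sup>2 = r ^ 7"
    using r by (simp add: power_mult_distrib power_numeral_reduce)
  ultimately have "(peak 8 (8 * k) * (r ^ 3 * sqrt r))\<^sup>2 \<le> 40\<^sup>2"
    by (simp add: power_mult_distrib)
  then have "peak 8 (8 * k) * (r ^ 3 * sqrt r) \<le> 40"
    by (rule power2_le_imp_le) simp
  then have "peak 8 (8 * k) \<le> 40 / (r ^ 3 * sqrt r)"
    using r by (subst pos_le_divide_eq) auto
  then show ?thesis using le unfolding r_def by linarith
qed


section \<open>Probability that two lines have close types\<close>

text \<open>The event \<open>R\<close> and the target \<open>\<tau>\<close> are fixed by the colors
  outside A, while the colors on A remain uniform, so the target is hit with probability at most the
  peak. Conditioning is replaced by an exchange of the colors on A.\<close>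

lemma card_prescribed_counts_le:
  fixes P :: "'a set" and q :: nat
  defines "\<Omega> \<equiv> P \<rightarrow>\<^sub>E {1..q}"
  assumes "finite P" "A \<subseteq> P" "0 < q"
    and R: "\<And>g h. (\<And>x. x \<notin> A \<Longrightarrow> g x = h x) \<Longrightarrow> R g = R h"
    and \<tau>: "\<And>g h. (\<And>x. x \<notin> A \<Longrightarrow> g x = h x) \<Longrightarrow> \<tau> g = \<tau> h"
  shows "real (card {g \<in> \<Omega>. R g \<and> (\<forall>i\<in>{1..q}. cnt g A i = \<tau> g i)})
    \<le> peak q (card A) * real (card {g \<in> \<Omega>. R g})"
proof -
  let ?S = "{g \<in> \<Omega>. R g \<and> (\<forall>i\<in>{1..q}. cnt g A i = \<tau> g i)}"
  let ?T = "{g \<in> \<Omega>. R g}"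
  let ?M = "\<lambda>t. colorings_with_counts q A (\<tau> t)"
  let ?f = "\<lambda>(g, a). (\<lambda>x. if x \<in> A then a x else g x, restrict g A)"
  have fA: "finite A" using assms(2,3) finite_subset by blast
  have f\<Omega>: "finite \<Omega>" using assms(2) unfolding \<Omega>_def by (simp add: finite_PiE)
  \<comment> \<open>The exchange sends (g, a) to g overwritten by a on A, together with the old
    colors of g on A. Both colorings agree outside A, so the old colors still realize the target
    that belongs to the new coloring.\<close>
  have "card (?S \<times> (A \<rightarrow>\<^sub>E {1..q})) \<le> card (Sigma ?T ?M)"
  proof (rule card_inj_on_le[where f = ?f])
    show "inj_on ?f (?S \<times> (A \<rightarrow>\<^sub>E {1..q}))"
    proof (rule inj_onI, clarsimp)
      fix g a h b
      assume ab: "a \<in> A \<rightarrow>\<^sub>E {Suc 0..q}" "b \<in> A \<rightarrow>\<^sub>E {Suc 0..q}"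
        and e: "(\<lambda>x. if x \<in> A then a x else g x) = (\<lambda>x. if x \<in> A then b x else h x)"
        and r: "restrict g A = restrict h A"
      have "g x = h x" for x
        using fun_cong[OF e, of x] fun_cong[OF r, of x] by (cases "x \<in> A") auto
      moreover have "a = b"
      proof (rule PiE_ext[OF ab])
        show "a x = b x" if "x \<in> A" for x using that fun_cong[OF e, of x] by auto
      qed
      ultimately show "g = h \<and> a = b" by auto
    qed
    show "?f ` (?S \<times> (A \<rightarrow>\<^sub>E {1..q})) \<subseteq> Sigma ?T ?M"
    proof (rule subsetI)
      fix y assume "y \<in> ?f ` (?S \<times> (A \<rightarrow>\<^sub>E {1..q}))"
      then obtain g a where g: "g \<in> ?S" and a: "a \<in> A \<rightarrow>\<^sub>E {1..q}" and y: "y = ?f (g, a)"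
        by blast
      define t where "t = (\<lambda>x. if x \<in> A then a x else g x)"
      have "t \<in> \<Omega>" using g a assms(3) unfolding \<Omega>_def t_def by (fastforce simp: PiE_iff extensional_def)
      moreover have "R t = R g" "\<tau> t = \<tau> g"
        by (rule R \<tau>; simp add: t_def)+
      moreover have "cnt (restrict g A) A i = cnt g A i" for i
        by (rule cnt_cong) auto
      moreover have "restrict g A \<in> A \<rightarrow>\<^sub>E {1..q}"
        using g assms(3) unfolding \<Omega>_def by auto
      ultimately have "(t, restrict g A) \<in> Sigma ?T ?M"
        using g unfolding colorings_with_counts_def by auto
      then show "y \<in> Sigma ?T ?M" using y unfolding t_def by simp
    qed
    show "finite (Sigma ?T ?M)"
      using f\<Omega> fA by (intro finite_SigmaI) (auto intro: finite_colorings_with_counts)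
  qed
  moreover have "card (Sigma ?T ?M) = (\<Sum>t\<in>?T. card (?M t))"
    using f\<Omega> fA by (intro card_SigmaI) (auto intro: finite_colorings_with_counts)
  moreover have "card (?S \<times> (A \<rightarrow>\<^sub>E {1..q})) = card ?S * q ^ card A"
    using fA by (simp add: card_cartesian_product card_PiE)
  ultimately have "card ?S * q ^ card A \<le> (\<Sum>t\<in>?T. card (?M t))" by simp
  then have "real (card ?S * q ^ card A) \<le> (\<Sum>t\<in>?T. real (card (?M t)))"
    by (simp only: of_nat_sum[symmetric] of_nat_le_iff)
  also have "\<dots> \<le> (\<Sum>t\<in>?T. real q ^ card A * peak q (card A))"
    by (intro sum_mono card_colorings_with_counts fA assms(4))
  finally have "real q ^ card A * real (card ?S)
      \<le> real q ^ card A * (peak q (card A) * real (card ?T))"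
    by (simp add: ac_simps)
  then show ?thesis using assms(4) by (subst (asm) mult_le_cancel_left_pos) auto
qed

text \<open>For s = 0 this is equality of types; the slack s = 400 will absorb the later
  recoloring.\<close>

definition near :: "nat \<Rightarrow> nat \<Rightarrow> ('a \<Rightarrow> nat) \<Rightarrow> 'a set \<Rightarrow> 'a set \<Rightarrow> bool" where
  "near q s g l m \<longleftrightarrow>
     (\<forall>i\<in>{1..q}. cnt g l i \<le> cnt g m i + s \<and> cnt g m i \<le> cnt g l i + s)"

lemma near_sym: "near q s g l m \<Longrightarrow> near q s g m l"
  unfolding near_def by auto

lemma near_mono: "near q s g l m \<Longrightarrow> s \<le> t \<Longrightarrow> near q t g l m"
  unfolding near_def by fastforce

lemma near_cong:
  assumes "\<And>x. x \<in> l \<union> m \<Longrightarrow> g x = h x"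
  shows "near q s g l m = near q s h l m"
proof -
  have "cnt g l i = cnt h l i" "cnt g m i = cnt h m i" for i
    using assms by (auto intro!: cnt_cong)
  then show ?thesis unfolding near_def by simp
qed

text \<open>The difference of the two types takes at most \<open>(2 * s + 1) ^ q\<close> values. For
  each of them the counts on A are forced by the colors outside A, since m and \<open>l - A\<close>
  are disjoint from A. The extra event \<open>R\<close> makes it possible to impose a second near
  pair.\<close>

lemma card_near_le:
  fixes P :: "'a set" and q :: nat
  defines "\<Omega> \<equiv> P \<rightarrow>\<^sub>E {1..q}"
  assumes "finite P" "A \<subseteq> l" "l \<subseteq> P" "A \<inter> m = {}" "0 < q"
    and R: "\<And>g h. (\<And>x. x \<notin> A \<Longrightarrow> g x = h x) \<Longrightarrow> R g = R h"
  shows "real (card {g \<in> \<Omega>. R g \<and> near q s g l m})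
    \<le> (2 * real s + 1) ^ q * peak q (card A) * real (card {g \<in> \<Omega>. R g})"
proof -
  \<comment> \<open>Here d is the difference of the types, shifted by s to stay natural. Truncation
    does no harm: for colorings in the event all subtractions are exact, and for the others
    \<open>\<tau>\<close> only has to depend on the colors outside A.\<close>
  define \<tau> where "\<tau> d g i = cnt g m i + d i - s - cnt g (l - A) i" for d g i
  define B where "B d = {g \<in> \<Omega>. R g \<and> (\<forall>i\<in>{1..q}. cnt g A i = \<tau> d g i)}" for d
  let ?D = "{1..q} \<rightarrow>\<^sub>E {0..2 * s}"
  have fl: "finite l" using assms(2,4) finite_subset by blast
  have f\<Omega>: "finite \<Omega>" using assms(2) unfolding \<Omega>_def by (simp add: finite_PiE)
  have "{g \<in> \<Omega>. R g \<and> near q s g l m} \<subseteq> (\<Union>d\<in>?D. B d)"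
  proof (rule subsetI)
    fix g assume g: "g \<in> {g \<in> \<Omega>. R g \<and> near q s g l m}"
    define d where "d = (\<lambda>i\<in>{1..q}. cnt g l i + s - cnt g m i)"
    have nr: "cnt g l i \<le> cnt g m i + s" "cnt g m i \<le> cnt g l i + s" if "i \<in> {1..q}" for i
      using g that unfolding near_def by auto
    have "d \<in> ?D" using nr unfolding d_def by fastforce
    moreover have "cnt g A i = \<tau> d g i" if "i \<in> {1..q}" for i
      using nr[OF that] cnt_split[OF fl assms(3), of g i] that unfolding \<tau>_def d_def by simp
    ultimately show "g \<in> (\<Union>d\<in>?D. B d)" using g unfolding B_def by blast
  qed
  then have "card {g \<in> \<Omega>. R g \<and> near q s g l m} \<le> card (\<Union>d\<in>?D. B d)"
    using f\<Omega> by (intro card_mono) (auto simp: B_def finite_PiE)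
  also have "\<dots> \<le> (\<Sum>d\<in>?D. card (B d))"
    by (intro card_UN_le) (simp add: finite_PiE)
  finally have "real (card {g \<in> \<Omega>. R g \<and> near q s g l m}) \<le> (\<Sum>d\<in>?D. real (card (B d)))"
    by (simp only: of_nat_sum[symmetric] of_nat_le_iff)
  also have "\<dots> \<le> (\<Sum>d\<in>?D. peak q (card A) * real (card {g \<in> \<Omega>. R g}))"
  proof (rule sum_mono)
    fix d
    show "real (card (B d)) \<le> peak q (card A) * real (card {g \<in> \<Omega>. R g})"
      unfolding B_def \<Omega>_def
    proof (rule card_prescribed_counts_le)
      show "A \<subseteq> P" using assms(3,4) by blast
      show "\<tau> d g = \<tau> d h" if "\<And>x. x \<notin> A \<Longrightarrow> g x = h x" for g h
      proof
        fix i
        have "cnt g m i = cnt h m i" "cnt g (l - A) i = cnt h (l - A) i"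
          using that assms(5) by (auto intro!: cnt_cong)
        then show "\<tau> d g i = \<tau> d h i" unfolding \<tau>_def by simp
      qed
      show "R g = R h" if "\<And>x. x \<notin> A \<Longrightarrow> g x = h x" for g h
        using that by (rule R)
    qed (fact assms)+
  qed
  also have "\<dots> = (2 * real s + 1) ^ q * peak q (card A) * real (card {g \<in> \<Omega>. R g})"
    by (simp add: card_PiE ac_simps)
  finally show ?thesis .
qed

text \<open>Linearity of expectation in counting form, by exchanging the order of summation.\<close>

lemma sum_card_le:
  assumes "finite S" "finite I" "\<And>i. i \<in> I \<Longrightarrow> real (card {g \<in> S. Q i g}) \<le> c"
  shows "(\<Sum>g\<in>S. real (card {i \<in> I. Q i g})) \<le> real (card I) * c"
proof -
  have "(\<Sum>g\<in>S. card {i \<in> I. Q i g}) = (\<Sum>i\<in>I. card {g \<in> S. Q i g})"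
    by (rule sum_multicount_gen) (use assms in auto)
  then have "(\<Sum>g\<in>S. real (card {i \<in> I. Q i g})) = (\<Sum>i\<in>I. real (card {g \<in> S. Q i g}))"
    by (simp only: of_nat_sum[symmetric])
  also have "\<dots> \<le> real (card I) * c"
    by (rule sum_bounded_above) (rule assms(3))
  finally show ?thesis .
qed

section \<open>Rich lines and private points\<close>

context finite_projective_plane
begin

lemma card_Int_line: "l \<in> L \<Longrightarrow> m \<in> L \<Longrightarrow> l \<noteq> m \<Longrightarrow> card (l \<inter> m) = 1"
  using unique_point[of l m] by (metis empty_iff is_singletonI' is_singleton_altdef)

text \<open>A line with at least t points in S contains at least t(t-1) ordered pairs of distinct
  points of S, and no such pair lies on two lines.\<close>

lemma card_rich_lines:
  assumes "S \<subseteq> P"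
  shows "card {m \<in> L. t \<le> card (m \<inter> S)} * (t * (t - 1)) \<le> (card S)\<^sup>2"
proof -
  let ?M = "{m \<in> L. t \<le> card (m \<inter> S)}"
  let ?Z = "\<lambda>m. SIGMA x:m \<inter> S. (m \<inter> S) - {x}"
  have fS: "finite S" using assms finite_points finite_subset by blast
  have "?M \<subseteq> L" by auto
  then have fM: "finite ?M" using finite_lines finite_subset by blast
  have Z: "card (?Z m) = card (m \<inter> S) * (card (m \<inter> S) - 1)" for m
    using fS by (subst card_SigmaI) auto
  have "card ?M * (t * (t - 1)) = (\<Sum>m\<in>?M. t * (t - 1))" by simp
  also have "\<dots> \<le> (\<Sum>m\<in>?M. card (?Z m))"
    unfolding Z by (intro sum_mono mult_mono) auto
  also have "\<dots> = card (Sigma ?M ?Z)" using fM fS by (subst card_SigmaI) auto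
  also have "\<dots> \<le> card (S \<times> S)"
  proof (rule card_inj_on_le[where f = snd])
    show "inj_on snd (Sigma ?M ?Z)"
      using unique_line assms by (intro inj_onI) (auto, blast+)
  qed (use fS in auto)
  also have "\<dots> = (card S)\<^sup>2" by (simp add: card_cartesian_product power2_eq_square)
  finally show ?thesis .
qed

text \<open>Greedy choice: a new point on l must avoid the other lines of D and the lines already
  holding t chosen points, of which \<open>card_rich_lines\<close> allows at most F. Each of these
  at most n lines meets l in one point, and l has n + 1 points.\<close>

lemma private_points:
  assumes "D \<subseteq> L" "2 \<le> t" "card D + F \<le> n" "U \<subseteq> D" "(card U)\<^sup>2 \<le> F * (t * (t - 1))"
  shows "\<exists>f. (\<forall>l\<in>U. f l \<in> l \<and> (\<forall>m\<in>D. m \<noteq> l \<longrightarrow> f l \<notin> m)) \<and> (\<forall>m\<in>L. card (m \<inter> f ` U) \<le> t)"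
proof -
  have fD: "finite D" using assms(1) finite_lines finite_subset by blast
  then have "finite U" using assms(4) finite_subset by blast
  then show ?thesis using assms(4,5)
  proof (induction U)
    case empty
    then show ?case by auto
  next
    case (insert l U)
    have "(card U)\<^sup>2 \<le> (card (insert l U))\<^sup>2"
      using insert.hyps by (intro power_mono) auto
    then have U: "(card U)\<^sup>2 \<le> F * (t * (t - 1))" using insert.prems by linarith
    then obtain f where f: "\<forall>l\<in>U. f l \<in> l \<and> (\<forall>m\<in>D. m \<noteq> l \<longrightarrow> f l \<notin> m)"
        "\<forall>m\<in>L. card (m \<inter> f ` U) \<le> t"
      using insert by auto
    have l: "l \<in> D" "l \<in> L" using insert.prems assms(1) by auto
    define full where "full = {m \<in> L. t \<le> card (m \<inter> f ` U)}"
    have "f ` U \<subseteq> P" using f(1) insert.prems assms(1) line_subset by blast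
    then have "card full * (t * (t - 1)) \<le> (card (f ` U))\<^sup>2"
      unfolding full_def by (rule card_rich_lines)
    also have "\<dots> \<le> (card U)\<^sup>2"
      using card_image_le[OF insert.hyps(1)] by (intro power_mono) auto
    finally have "card full * (t * (t - 1)) \<le> F * (t * (t - 1))" using U by linarith
    then have cfull: "card full \<le> F" using assms(2) by simp
    \<comment> \<open>The line l itself is exempt: it belongs to D, so no point chosen earlier lies
      on it and the new point cannot overfill it.\<close>
    define E where "E = (D \<union> full) - {l}"
    have fE: "finite E" "E \<subseteq> L"
      unfolding E_def full_def using fD finite_lines assms(1) by auto
    have "card E \<le> card (D \<union> full)"
      unfolding E_def full_def using fD finite_lines by (intro card_mono) auto
    also have "\<dots> \<le> card D + card full" by (rule card_Un_le)
    finally have cE: "card E \<le> n" using cfull assms(3) by linarith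
    have "card (\<Union>m\<in>E. l \<inter> m) \<le> (\<Sum>m\<in>E. card (l \<inter> m))" by (rule card_UN_le[OF fE(1)])
    also have "\<dots> = (\<Sum>m\<in>E. 1)"
    proof (rule sum.cong)
      fix m assume "m \<in> E"
      then show "card (l \<inter> m) = 1" using card_Int_line[of l m] l fE(2) unfolding E_def by blast
    qed simp
    also have "\<dots> \<le> n" using cE by simp
    finally have "card (\<Union>m\<in>E. l \<inter> m) < card l" using card_line[OF l(2)] by simp
    then have "\<not> l \<subseteq> (\<Union>m\<in>E. l \<inter> m)"
      using fE(1) finite_line[OF l(2)] card_mono[of "\<Union>m\<in>E. l \<inter> m" l] by fastforce
    then obtain p where p: "p \<in> l" "\<And>m. m \<in> E \<Longrightarrow> p \<notin> m" by blast
    have im: "(f(l := p)) ` insert l U = insert p (f ` U)" using insert.hyps by auto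
    have le: "card (m \<inter> insert p (f ` U)) \<le> t" if m: "m \<in> L" for m
    proof (cases "p \<in> m")
      case False
      then have "m \<inter> insert p (f ` U) = m \<inter> f ` U" by auto
      then show ?thesis using f(2) m by simp
    next
      case True
      have "card (m \<inter> f ` U) < t"
      proof (cases "m = l")
        case True
        have "f k \<notin> l" if "k \<in> U" for k
          using f(1) l(1) insert.hyps(2) that by metis
        then have "l \<inter> f ` U = {}" by auto
        then show ?thesis using True assms(2) by simp
      next
        case False
        then have "m \<notin> full" using True p(2) unfolding E_def by blast
        then show ?thesis using m unfolding full_def by simp
      qed
      moreover have "m \<inter> insert p (f ` U) = insert p (m \<inter> f ` U)" using True by auto
      ultimately show ?thesis
        using insert.hyps(1) card_insert_le_m1[of t "m \<inter> f ` U" p] assms(2)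
        by (simp add: card_insert_if)
    qed
    show ?case
    proof (rule exI[of _ "f(l := p)"], intro conjI ballI)
      fix k assume k: "k \<in> insert l U"
      show "(f(l := p)) k \<in> k" using k p(1) f(1) by auto
    next
      fix k m assume k: "k \<in> insert l U" and m: "m \<in> D"
      show "m \<noteq> k \<longrightarrow> (f(l := p)) k \<notin> m"
        using k m f(1) p(2) insert.hyps(2) unfolding E_def by auto
    next
      fix m assume "m \<in> L"
      then show "card (m \<inter> (f(l := p)) ` insert l U) \<le> t" unfolding im by (rule le)
    qed
  qed
qed

section \<open>Average numbers of close pairs and triples\<close>

text \<open>The n points of \<open>l - m\<close> are the free ones; the bound is weakened to n - 1
  points so that pairs and triples share one constant.\<close>

lemma card_near_lines_le:
  assumes "l \<in> L" "m \<in> L" "l \<noteq> m" "0 < q"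
  shows "real (card {g \<in> P \<rightarrow>\<^sub>E {1..q}. near q s g l m})
    \<le> (2 * real s + 1) ^ q * peak q (n - 1) * real (card (P \<rightarrow>\<^sub>E {1..q}))"
proof -
  have "real (card {g \<in> P \<rightarrow>\<^sub>E {1..q}. True \<and> near q s g l m})
    \<le> (2 * real s + 1) ^ q * peak q (card (l - m)) * real (card {g \<in> P \<rightarrow>\<^sub>E {1..q}. True})"
    by (rule card_near_le) (use assms finite_points line_subset in auto)
  moreover have "card (l - m) = n"
    using card_Int_line[OF assms(1-3)] card_line[OF assms(1)] finite_line[OF assms(1)]
    by (simp add: card_Diff_subset_Int)
  ultimately show ?thesis
    using peak_antimono[OF assms(4), of "n - 1" n]
    by (auto elim!: order_trans intro!: mult_right_mono mult_left_mono)
qed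

text \<open>The points of l off m and k have no influence on whether m and k are near, so that event
  can serve as \<open>R\<close> and the two bounds multiply.\<close>

lemma card_near_triple_le:
  assumes "l \<in> L" "m \<in> L" "k \<in> L" "l \<noteq> m" "l \<noteq> k" "m \<noteq> k" "0 < q"
  shows "real (card {g \<in> P \<rightarrow>\<^sub>E {1..q}. near q s g m k \<and> near q s g l k})
    \<le> ((2 * real s + 1) ^ q * peak q (n - 1))\<^sup>2 * real (card (P \<rightarrow>\<^sub>E {1..q}))"
proof -
  let ?A = "l - (m \<union> k)" and ?W = "(2 * real s + 1) ^ q"
  have "card (l \<inter> (m \<union> k)) \<le> card (l \<inter> m) + card (l \<inter> k)"
    unfolding Int_Un_distrib by (rule card_Un_le)
  then have "n - 1 \<le> card ?A"
    using card_Int_line assms card_line[OF assms(1)] finite_line[OF assms(1)]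
    by (simp add: card_Diff_subset_Int)
  then have pk: "peak q (card ?A) \<le> peak q (n - 1)" by (rule peak_antimono[OF assms(7)])
  have "real (card {g \<in> P \<rightarrow>\<^sub>E {1..q}. near q s g m k \<and> near q s g l k})
    \<le> ?W * peak q (card ?A) * real (card {g \<in> P \<rightarrow>\<^sub>E {1..q}. near q s g m k})"
  proof (rule card_near_le)
    show "near q s g m k = near q s h m k" if "\<And>x. x \<notin> ?A \<Longrightarrow> g x = h x" for g h
      using that by (intro near_cong) auto
  qed (use assms finite_points line_subset in auto)
  also have "\<dots> \<le> ?W * peak q (n - 1) * (?W * peak q (n - 1) * real (card (P \<rightarrow>\<^sub>E {1..q})))"
    using pk peak_nonneg assms
    by (intro mult_mono card_near_lines_le mult_left_mono mult_nonneg_nonneg) auto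
  finally show ?thesis by (simp add: power2_eq_square ac_simps)
qed

text \<open>Pairs are ordered, so each unordered pair occurs twice. Filtering a fixed index set fits
  the form of \<open>sum_card_le\<close>.\<close>

definition near_pairs :: "nat \<Rightarrow> nat \<Rightarrow> ('a \<Rightarrow> nat) \<Rightarrow> ('a set \<times> 'a set) set" where
  "near_pairs q s g =
     {p \<in> {(l, m). l \<in> L \<and> m \<in> L \<and> l \<noteq> m}. near q s g (fst p) (snd p)}"

lemma finite_near_pairs: "finite (near_pairs q s g)"
  by (rule finite_subset[of _ "L \<times> L"]) (auto simp: near_pairs_def finite_lines)

lemma sum_near_pairs_le:
  assumes "0 < q"
  shows "(\<Sum>g\<in>P \<rightarrow>\<^sub>E {1..q}. real (card (near_pairs q s g)))
    \<le> (real (card L))\<^sup>2 * ((2 * real s + 1) ^ q * peak q (n - 1)) * real (card (P \<rightarrow>\<^sub>E {1..q}))"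
proof -
  let ?J = "{(l, m). l \<in> L \<and> m \<in> L \<and> l \<noteq> m}"
  let ?c = "(2 * real s + 1) ^ q * peak q (n - 1) * real (card (P \<rightarrow>\<^sub>E {1..q}))"
  have sub: "?J \<subseteq> L \<times> L" by auto
  have "(\<Sum>g\<in>P \<rightarrow>\<^sub>E {1..q}. real (card (near_pairs q s g))) \<le> real (card ?J) * ?c"
    unfolding near_pairs_def
  proof (rule sum_card_le)
    show "finite ?J" using sub finite_lines finite_subset by blast
    show "finite (P \<rightarrow>\<^sub>E {1..q})" using finite_points by (simp add: finite_PiE)
    show "real (card {g \<in> P \<rightarrow>\<^sub>E {1..q}. near q s g (fst p) (snd p)}) \<le> ?c" if "p \<in> ?J" for p
      using that by (intro card_near_lines_le assms) auto
  qed
  also have "\<dots> \<le> (real (card L))\<^sup>2 * ?c"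
  proof (rule mult_right_mono)
    have "card ?J \<le> card (L \<times> L)" using sub finite_lines by (intro card_mono) auto
    then show "real (card ?J) \<le> (real (card L))\<^sup>2"
      by (simp add: card_cartesian_product power2_eq_square flip: of_nat_mult)
  qed (simp add: peak_nonneg)
  finally show ?thesis by (simp only: mult.assoc)
qed

text \<open>The last component is the line to which the other two are near.\<close>

definition near_triples :: "nat \<Rightarrow> nat \<Rightarrow> ('a \<Rightarrow> nat) \<Rightarrow> ('a set \<times> 'a set \<times> 'a set) set" where
  "near_triples q s g =
     {p \<in> {(l, m, k). l \<in> L \<and> m \<in> L \<and> k \<in> L \<and> l \<noteq> m \<and> l \<noteq> k \<and> m \<noteq> k}.
        near q s g (fst (snd p)) (snd (snd p)) \<and> near q s g (fst p) (snd (snd p))}"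

lemma finite_near_triples: "finite (near_triples q s g)"
  by (rule finite_subset[of _ "L \<times> L \<times> L"]) (auto simp: near_triples_def finite_lines)

lemma sum_near_triples_le:
  assumes "0 < q"
  shows "(\<Sum>g\<in>P \<rightarrow>\<^sub>E {1..q}. real (card (near_triples q s g)))
    \<le> real (card L) ^ 3 * ((2 * real s + 1) ^ q * peak q (n - 1))\<^sup>2 * real (card (P \<rightarrow>\<^sub>E {1..q}))"
proof -
  let ?J = "{(l, m, k). l \<in> L \<and> m \<in> L \<and> k \<in> L \<and> l \<noteq> m \<and> l \<noteq> k \<and> m \<noteq> k}"
  let ?c = "((2 * real s + 1) ^ q * peak q (n - 1))\<^sup>2 * real (card (P \<rightarrow>\<^sub>E {1..q}))"
  have sub: "?J \<subseteq> L \<times> L \<times> L" by auto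
  have "(\<Sum>g\<in>P \<rightarrow>\<^sub>E {1..q}. real (card (near_triples q s g))) \<le> real (card ?J) * ?c"
    unfolding near_triples_def
  proof (rule sum_card_le)
    show "finite ?J" by (rule finite_subset[OF sub]) (simp add: finite_lines)
    show "finite (P \<rightarrow>\<^sub>E {1..q})" using finite_points by (simp add: finite_PiE)
    show "real (card {g \<in> P \<rightarrow>\<^sub>E {1..q}. near q s g (fst (snd p)) (snd (snd p)) \<and>
        near q s g (fst p) (snd (snd p))}) \<le> ?c" if "p \<in> ?J" for p
      using that by (intro card_near_triple_le assms) auto
  qed
  also have "\<dots> \<le> real (card L) ^ 3 * ?c"
  proof (rule mult_right_mono)
    have "card ?J \<le> card (L \<times> L \<times> L)" using sub finite_lines by (intro card_mono) auto
    then show "real (card ?J) \<le> real (card L) ^ 3"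
      by (simp add: card_cartesian_product power3_eq_cube mult.assoc flip: of_nat_mult)
  qed simp
  finally show ?thesis by (simp only: mult.assoc)
qed

section \<open>Existence of a coloring with few close pairs and no close triples\<close>

text \<open>Markov's inequality for three quantities at once: divided by the thresholds to be
  avoided, the numbers of equal pairs, close pairs and close triples average at most 1/2, 1/10 and
  1/10, which add up to less than 1.\<close>

lemma ex_sparse_coloring:
  assumes n: "n > 10 ^ 54"
  shows "\<exists>g\<in>P \<rightarrow>\<^sub>E {1..8}. real (card (near_pairs 8 0 g)) < 100 * sqrt (real n) \<and>
    real (card (near_pairs 8 400 g)) < real n / 2 \<and> near_triples 8 400 g = {}"
proof (rule ccontr)
  define \<Omega> where "\<Omega> = P \<rightarrow>\<^sub>E {1..8::nat}"
  define N where "N = real (card \<Omega>)"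
  define r where "r = sqrt (real n)"
  define v where "v = real (card L)"
  define p where "p = peak 8 (n - 1)"
  \<comment> \<open>As 801 = 2 * 400 + 1, this bounds the number of difference vectors for slack
    400.\<close>
  define w :: real where "w = 801 ^ 8"
  define X where "X g = real (card (near_pairs 8 0 g))" for g
  define Y where "Y g = real (card (near_pairs 8 400 g))" for g
  define Z where "Z g = real (card (near_triples 8 400 g))" for g
  assume neg: "\<not> ?thesis"
  have "(10::real) ^ 54 < real n" using n by (metis of_nat_less_iff of_nat_numeral of_nat_power)
  moreover have "(10::real) ^ 54 = (10 ^ 27)\<^sup>2" by simp
  \<comment> \<open>The size of n enters as r >= 10^27, to be weighed against w <= 2 *
    10^23.\<close>
  ultimately have "10 ^ 27 < r" unfolding r_def using real_less_rsqrt by metis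
  then have r: "1000000000000000000000000000 \<le> r" by simp
  have rr: "real n = r\<^sup>2" unfolding r_def by simp
  have p0: "0 \<le> p" unfolding p_def by (rule peak_nonneg)
  have "1000 \<le> n" using n by (rule order_trans[rotated, OF less_imp_le]) simp
  then have "p \<le> 40 / (real n ^ 3 * sqrt (real n))" unfolding p_def by (rule peak_8_bound)
  then have p: "p \<le> 40 / r ^ 7"
    unfolding r_def[symmetric] rr using r by (simp add: power_mult[symmetric] power_Suc2[symmetric])
  have "v = r ^ 4 + r\<^sup>2 + 1"
    unfolding v_def card_lines by (simp add: rr power_mult[symmetric])
  moreover have "1000 * r\<^sup>2 \<le> r\<^sup>2 * r\<^sup>2" "1000 * 1 \<le> r\<^sup>2 * r\<^sup>2"
  proof -
    have "1000 * 1 \<le> r * r" using r by (intro mult_mono) auto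
    then have "1000 \<le> r\<^sup>2" by (simp add: power2_eq_square)
    then show "1000 * r\<^sup>2 \<le> r\<^sup>2 * r\<^sup>2" "1000 * 1 \<le> r\<^sup>2 * r\<^sup>2" by (intro mult_mono; simp)+
  qed
  moreover have "r\<^sup>2 * r\<^sup>2 = r ^ 4" by (simp flip: power_add)
  ultimately have v: "v \<le> 101 / 100 * r ^ 4" by linarith
  have v0: "0 \<le> v" unfolding v_def by simp
  \<comment> \<open>With v about r^4 and p at most 40 / r^7, equal pairs average to order r, close
    pairs to order w r, which is small against r^2, and close triples to order w^2 / r^2.\<close>
  have "v\<^sup>2 * p \<le> (101 / 100 * r ^ 4)\<^sup>2 * (40 / r ^ 7)"
    using v p v0 p0 r by (intro mult_mono power_mono) auto
  also have "\<dots> = (101 / 100)\<^sup>2 * 40 * r"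
    using r by (simp add: power_mult_distrib power_mult[symmetric] field_simps flip: power_Suc)
  finally have vp: "v\<^sup>2 * p \<le> 50 * r" using r by (simp add: power2_eq_square)
  have w: "0 \<le> w" "w \<le> 200000000000000000000000" unfolding w_def by simp_all
  have "w * (v\<^sup>2 * p) \<le> 200000000000000000000000 * (50 * r)"
    using w v0 p0 by (intro mult_mono[OF _ vp]) auto
  also have "\<dots> \<le> (1000000000000000000000000000 / 20) * r" using r by simp
  also have "\<dots> \<le> r / 20 * r" using r by simp
  finally have vwp: "w * (v\<^sup>2 * p) \<le> r\<^sup>2 / 20" by (simp add: power2_eq_square)
  have "v ^ 3 * (w * p)\<^sup>2 \<le> (101 / 100 * r ^ 4) ^ 3 * (200000000000000000000000 * (40 / r ^ 7))\<^sup>2"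
    using v p v0 p0 r w by (intro mult_mono power_mono) auto
  also have "\<dots> = (101 / 100) ^ 3 * (200000000000000000000000 * 40)\<^sup>2 * (r ^ 12 / r ^ 14)"
    by (simp add: power_mult_distrib power_divide power_mult[symmetric])
  also have "r ^ 12 / r ^ 14 = (1 / r)\<^sup>2"
    using r by (simp add: power_divide field_simps flip: power_add)
  also have "\<dots> \<le> (1 / 1000000000000000000000000000)\<^sup>2"
    using r by (intro power_mono divide_left_mono) auto
  finally have vwp2: "v ^ 3 * (w * p)\<^sup>2 \<le> 1 / 10"
    by (simp add: power2_eq_square power3_eq_cube)

  have f\<Omega>: "finite \<Omega>" unfolding \<Omega>_def using finite_points by (simp add: finite_PiE)
  have "(\<lambda>x\<in>P. 1) \<in> \<Omega>" unfolding \<Omega>_def by auto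
  then have N: "0 < N" unfolding N_def using f\<Omega> by (auto simp: card_gt_0_iff)
  have sX: "sum X \<Omega> \<le> 50 * r * N"
    using sum_near_pairs_le[of 8 0] mult_right_mono[OF vp less_imp_le[OF N]]
    unfolding X_def \<Omega>_def N_def p_def v_def by simp
  have sY: "sum Y \<Omega> \<le> r\<^sup>2 / 20 * N"
    using sum_near_pairs_le[of 8 400] mult_right_mono[OF vwp less_imp_le[OF N]]
    unfolding Y_def \<Omega>_def N_def p_def v_def w_def by (simp add: ac_simps)
  have sZ: "sum Z \<Omega> \<le> 1 / 10 * N"
    using sum_near_triples_le[of 8 400] mult_right_mono[OF vwp2 less_imp_le[OF N]]
    unfolding Z_def \<Omega>_def N_def p_def v_def w_def by simp
  \<comment> \<open>A coloring that fails the claim reaches one of the three thresholds, so one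
    summand is at least 1.\<close>
  have "1 \<le> X g / (100 * r) + Y g / (r\<^sup>2 / 2) + Z g" if g: "g \<in> \<Omega>" for g
  proof -
    have nn: "0 \<le> X g / (100 * r)" "0 \<le> Y g / (r\<^sup>2 / 2)" "0 \<le> Z g"
      unfolding X_def Y_def Z_def using r by auto
    have "\<not> X g < 100 * r \<or> \<not> Y g < r\<^sup>2 / 2 \<or> near_triples 8 400 g \<noteq> {}"
      using neg g unfolding X_def Y_def r_def \<Omega>_def by auto
    then consider "100 * r \<le> X g" | "r\<^sup>2 / 2 \<le> Y g" | "1 \<le> Z g"
      unfolding Z_def using finite_near_triples by (force simp: Suc_le_eq card_gt_0_iff)
    then show ?thesis
    proof cases
      case 1
      then have "1 \<le> X g / (100 * r)" using r by simp
      then show ?thesis using nn by linarith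
    next
      case 2
      then have "1 \<le> Y g / (r\<^sup>2 / 2)" using r by simp
      then show ?thesis using nn by linarith
    qed (use nn in linarith)
  qed
  then have "(\<Sum>g\<in>\<Omega>. 1) \<le> (\<Sum>g\<in>\<Omega>. X g / (100 * r) + Y g / (r\<^sup>2 / 2) + Z g)"
    by (rule sum_mono)
  also have "\<dots> = sum X \<Omega> / (100 * r) + sum Y \<Omega> / (r\<^sup>2 / 2) + sum Z \<Omega>"
    by (simp only: sum.distrib sum_divide_distrib)
  also have "\<dots> \<le> 50 * r * N / (100 * r) + r\<^sup>2 / 20 * N / (r\<^sup>2 / 2) + 1 / 10 * N"
    using sX sY sZ r by (intro add_mono divide_right_mono) auto
  also have "\<dots> = 7 / 10 * N" using r by simp
  finally have "N \<le> 7 / 10 * N" by (simp add: N_def)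
  then show False using N by simp
qed

section \<open>Separation of equal types by recoloring\<close>

text \<open>\<open>F\<close> is the budget of full lines in \<open>private_points\<close>, applied
  with t = 200. Without near triples every line is near at most one other line, so the pairs can be
  repaired independently of each other.\<close>

lemma recolor_legitimate:
  assumes g: "g \<in> P \<rightarrow> {1..8}"
    and U: "(card (near_pairs 8 0 g))\<^sup>2 \<le> F * (200 * 199)"
    and D: "card (near_pairs 8 400 g) + F \<le> n"
    and T: "near_triples 8 400 g = {}"
  shows "\<exists>h. legitimate_coloring P L 8 h"
proof -
  \<comment> \<open>An injective numbering breaks the symmetry: of two lines of equal type the one
    with the smaller number is recolored.\<close>
  obtain idx :: "'a set \<Rightarrow> nat" where idx: "inj_on idx L"
    using finite_imp_inj_to_nat_seg[OF finite_lines] by blast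
  define D where "D = fst ` near_pairs 8 400 g"
  define U where "U = {l \<in> L. \<exists>m\<in>L. near 8 0 g l m \<and> idx l < idx m}"
  have inD: "l \<in> D \<and> m \<in> D" if "l \<in> L" "m \<in> L" "l \<noteq> m" "near 8 400 g l m" for l m
  proof -
    have "(l, m) \<in> near_pairs 8 400 g" "(m, l) \<in> near_pairs 8 400 g"
      using that near_sym[of 8 400 g l m] unfolding near_pairs_def by auto
    then show ?thesis unfolding D_def by force
  qed
  have mate: "m = k" if "l \<in> L" "m \<in> L" "k \<in> L" "near 8 400 g l m" "near 8 400 g l k"
      "l \<noteq> m" "l \<noteq> k" for l m k
  proof (rule ccontr)
    assume "m \<noteq> k"
    then have "(m, k, l) \<in> near_triples 8 400 g"
      using that near_sym[of 8 400 g l] unfolding near_triples_def by auto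
    then show False using T by simp
  qed
  have DL: "D \<subseteq> L" unfolding D_def near_pairs_def by auto
  have bad: "near 8 400 g l m \<and> l \<noteq> m" if "near 8 0 g l m" "idx l < idx m" for l m
    using that near_mono[of 8 0 g l m 400] by auto
  have UD: "U \<subseteq> D"
    unfolding U_def using inD bad by blast
  have "U \<subseteq> fst ` near_pairs 8 0 g"
  proof
    fix l assume "l \<in> U"
    then obtain m where "l \<in> L" "m \<in> L" "near 8 0 g l m" "idx l < idx m"
      unfolding U_def by blast
    then have "(l, m) \<in> near_pairs 8 0 g" unfolding near_pairs_def by auto
    then show "l \<in> fst ` near_pairs 8 0 g" by force
  qed
  then have "card U \<le> card (near_pairs 8 0 g)"
    by (rule surj_card_le[OF finite_near_pairs])
  then have "(card U)\<^sup>2 \<le> (card (near_pairs 8 0 g))\<^sup>2" by (intro power_mono) auto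
  then have "(card U)\<^sup>2 \<le> F * (200 * 199)" using U by linarith
  then have cU: "(card U)\<^sup>2 \<le> F * (200 * (200 - 1))" by (rule order_trans) simp
  have cD: "card D + F \<le> n"
    using assms(3) card_image_le[OF finite_near_pairs, of fst 8 400 g] unfolding D_def by linarith
  have "\<exists>f. (\<forall>l\<in>U. f l \<in> l \<and> (\<forall>m\<in>D. m \<noteq> l \<longrightarrow> f l \<notin> m)) \<and>
      (\<forall>m\<in>L. card (m \<inter> f ` U) \<le> 200)"
    by (rule private_points[OF DL _ cD UD cU]) simp
  then obtain f where
      "\<forall>l\<in>U. f l \<in> l \<and> (\<forall>m\<in>D. m \<noteq> l \<longrightarrow> f l \<notin> m)" "\<forall>m\<in>L. card (m \<inter> f ` U) \<le> 200"
    by (elim exE conjE)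
  then have f: "\<And>l. l \<in> U \<Longrightarrow> f l \<in> l"
      "\<And>l m. l \<in> U \<Longrightarrow> m \<in> D \<Longrightarrow> m \<noteq> l \<Longrightarrow> f l \<notin> m"
      "\<And>m. m \<in> L \<Longrightarrow> card (m \<inter> f ` U) \<le> 200"
    by simp_all
  define h where "h x = (if x \<in> f ` U then (if g x = 1 then 2 else 1) else g x)" for x
  have h_ne: "h x \<noteq> g x" if "x \<in> f ` U" for x using that unfolding h_def by auto
  have h_eq: "h x = g x" if "x \<notin> f ` U" for x using that unfolding h_def by auto
  \<comment> \<open>The point chosen for a line of U lies on no other line of D.\<close>
  have same: "cnt h m i = cnt g m i" if "m \<in> D" "m \<notin> U" for m i
    using that f(2) by (intro cnt_cong h_eq) blast
  \<comment> \<open>The only recolored point of l is \<open>f l\<close>, because the points chosen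
    for other lines avoid l. Its old color is therefore lost once and gained nowhere on l.\<close>
  have changed: "cnt g l (g (f l)) = cnt h l (g (f l)) + 1" if l: "l \<in> U" for l
  proof -
    have lL: "l \<in> L" "{f l} \<subseteq> l" using l f(1) unfolding U_def by auto
    have "cnt g (l - {f l}) (g (f l)) = cnt h (l - {f l}) (g (f l))"
    proof (rule cnt_cong)
      fix x assume x: "x \<in> l - {f l}"
      have "x \<notin> f ` U"
      proof
        assume "x \<in> f ` U"
        then obtain k where "k \<in> U" "x = f k" by blast
        then show False using x f(2)[of k l] l UD by (cases "k = l") auto
      qed
      then show "g x = h x" using h_eq by simp
    qed
    moreover have "{x \<in> {f l}. g x = g (f l)} = {f l}" "{x \<in> {f l}. h x = g (f l)} = {}"
      using h_ne[of "f l"] l by auto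
    then have "cnt g {f l} (g (f l)) = 1" "cnt h {f l} (g (f l)) = 0"
      unfolding cnt_def by simp_all
    ultimately show ?thesis using cnt_split[OF finite_line[OF lL(1)] lL(2)] by simp
  qed
  \<comment> \<open>A line holds at most 200 recolored points, so each count moves by at most 200
    and the difference of two counts by at most 400. Hence the slack 400.\<close>
  have close: "cnt h m i \<le> cnt g m i + 200 \<and> cnt g m i \<le> cnt h m i + 200" if m: "m \<in> L" for m i
  proof -
    have fin: "finite m" using m by (rule finite_line)
    have step: "cnt a m i \<le> cnt b m i + 200" if "\<And>x. x \<notin> f ` U \<Longrightarrow> a x = b x" for a b :: "'a \<Rightarrow> nat"
    proof -
      have "{x \<in> m. a x = i} \<subseteq> {x \<in> m. b x = i} \<union> (m \<inter> f ` U)" using that by auto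
      then have "cnt a m i \<le> card ({x \<in> m. b x = i} \<union> (m \<inter> f ` U))"
        unfolding cnt_def using fin by (intro card_mono) auto
      also have "\<dots> \<le> cnt b m i + card (m \<inter> f ` U)" unfolding cnt_def by (rule card_Un_le)
      finally show ?thesis using f(3)[OF m] by linarith
    qed
    show ?thesis using step[of h g] step[of g h] h_eq by simp
  qed
  have hP: "h \<in> P \<rightarrow> {1..8}" using g unfolding h_def by auto
  have differ: "\<exists>i\<in>{1..8}. cnt h l i \<noteq> cnt h m i"
    if lm: "l \<in> L" "m \<in> L" "idx l < idx m" for l m
  proof -
    have ne: "l \<noteq> m" using lm by auto
    show ?thesis
    proof (cases "near 8 400 g l m")
      case False
      then obtain i where "i \<in> {1..8}" "\<not> (cnt g l i \<le> cnt g m i + 400 \<and> cnt g m i \<le> cnt g l i + 400)"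
        unfolding near_def by blast
      then show ?thesis using close[OF lm(1), of i] close[OF lm(2), of i] by (intro bexI[of _ i]) auto
    next
      case True
      note inD = inD[OF lm(1,2) ne True]
      \<comment> \<open>A recolored line has a partner of equal type and larger number, and by
        \<open>mate\<close> this partner is the other line of the near pair. So only l can be
        recolored, and only if the types were equal.\<close>
      have only: "near 8 0 g l m \<and> k = l" if k: "k \<in> U" "k \<in> {l, m}" for k
      proof -
        obtain k' where k': "k' \<in> L" "near 8 0 g k k'" "idx k < idx k'"
          using k unfolding U_def by blast
        then have nk: "near 8 400 g k k'" "k \<noteq> k'" using near_mono[of 8 0 g k k' 400] by auto
        show ?thesis
        proof (cases "k = l")
          case True
          then have "m = k'" using mate[of l m k'] lm ne \<open>near 8 400 g l m\<close> nk k'(1) by blast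
          then show ?thesis using k' True by simp
        next
          case False
          then have "k = m" using k by simp
          then have "l = k'"
            using mate[of m l k'] lm ne near_sym[OF \<open>near 8 400 g l m\<close>] nk k'(1) by blast
          then show ?thesis using k'(3) \<open>k = m\<close> lm(3) by simp
        qed
      qed
      then have m: "m \<notin> U" using ne by blast
      \<comment> \<open>If l is recolored, the types were equal and only that of l changes.
        Otherwise neither changes, and they differed already, since l would belong to
        \<open>U\<close> if they were equal.\<close>
      show ?thesis
      proof (cases "l \<in> U")
        case True
        let ?c = "g (f l)"
        have "f l \<in> P" using f(1)[OF True] lm line_subset by blast
        then have c: "?c \<in> {1..8}" using g by blast
        then have "cnt g l ?c = cnt g m ?c" using only[OF True] unfolding near_def by fastforce
        then show ?thesis using changed[OF True] same[OF _ m] inD c by (intro bexI[of _ ?c]) auto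
      next
        case False
        have "\<not> near 8 0 g l m" using False lm unfolding U_def by blast
        then obtain i where "i \<in> {1..8}" "cnt g l i \<noteq> cnt g m i" unfolding near_def by fastforce
        then show ?thesis using same m False inD by auto
      qed
    qed
  qed
  have "line_type 8 h l \<noteq> line_type 8 h m" if lm: "l \<in> L" "m \<in> L" "l \<noteq> m" for l m
  proof
    assume eq: "line_type 8 h l = line_type 8 h m"
    have "cnt h l i = cnt h m i" if "i \<in> {1..8}" for i
    proof -
      have "l \<inter> h -` {i} = {x \<in> l. h x = i}" "m \<inter> h -` {i} = {x \<in> m. h x = i}" by auto
      then show ?thesis using fun_cong[OF eq, of i] that unfolding line_type_def cnt_def by simp
    qed
    moreover have "idx l \<noteq> idx m" using idx lm by (auto dest: inj_onD)
    ultimately show False using differ[of l m] differ[of m l] lm by (metis linorder_neqE_nat)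
  qed
  then show ?thesis unfolding legitimate_coloring_def using hP by blast
qed

end

theorem mainTheorem3:
  fixes P :: "'a set" and L :: "'a set set" and n :: nat
  assumes "finite_projective_plane P L n"
    and "n > 10 ^ 54"
  shows "\<exists>g. legitimate_coloring P L 8 g"
proof -
  interpret finite_projective_plane P L n by (rule assms(1))
  obtain g where g: "g \<in> P \<rightarrow>\<^sub>E {1..8}" "real (card (near_pairs 8 0 g)) < 100 * sqrt (real n)"
      "real (card (near_pairs 8 400 g)) < real n / 2" "near_triples 8 400 g = {}"
    using ex_sparse_coloring[OF assms(2)] by blast
  have n: "1000 \<le> n" using assms(2) by (rule order_trans[rotated, OF less_imp_le]) simp
  have "(real (card (near_pairs 8 0 g)))\<^sup>2 \<le> (100 * sqrt (real n))\<^sup>2"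
    using g(2) by (intro power_mono) auto
  then have "real ((card (near_pairs 8 0 g))\<^sup>2) \<le> real (10000 * n)"
    by (simp add: power_mult_distrib)
  then have a: "(card (near_pairs 8 0 g))\<^sup>2 \<le> 10000 * n" by (simp only: of_nat_le_iff)
  have b: "2 * card (near_pairs 8 400 g) < n" using g(3) by linarith
  \<comment> \<open>The budget \<open>n div 3\<close> meets both demands: 10000 n is at most
    \<open>(n div 3) * 39800\<close>, and n/2 + n/3 <= n.\<close>
  show ?thesis
  proof (rule recolor_legitimate)
    show "g \<in> P \<rightarrow> {1..8}" using g(1) by auto
    show "(card (near_pairs 8 0 g))\<^sup>2 \<le> (n div 3) * (200 * 199)" using a n by linarith
    show "card (near_pairs 8 400 g) + n div 3 \<le> n" using b by linarith
  qed (rule g(4))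
qed

end
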